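(* Let $n\ge 2$, $\varepsilon>0$ and $0<p\le 2$. For $y\in\mathbb{R}^{n(n-1)/2}$ let $X(y)$ denote the symmetric $n\times n$ matrix with unit diagonal whose strictly upper triangular part is given by $y$, and let $$f(y)=\operatorname{tr}\left(X(y)^{T}X(y)+\varepsilon I\right)^{p/2},$$ i.e. the trace of the matrix power $\left(X(y)^{T}X(y)+\varepsilon I\right)^{p/2}$. Let $x\in\mathbb{R}^{n(n-1)/2}$ be such that $X(x)\succeq 0$. Then for every step size $\alpha$ with $0\le\alpha\le\frac{1}{2p}\,\varepsilon^{(2-p)/2}$ we have $X(x-\alpha\nabla f(x))\succeq 0$.
   Context: All matrices are real; $X\succeq 0$ means that $X$ is symmetric positive semidefinite, and $I$ is the $n\times n$ identity matrix. For a vector $y=(y_1,\dots,y_{n(n-1)/2})$, the matrix $X(y)$ is defined by $X(y)_{ii}=1$ for all $i$, and, for $i<j$, $X(y)_{ij}=X(y)_{ji}=y_d$ with $d=\sum_{k=1}^{i-1}(n-k)+j-i$ (that is, $y$ lists the strictly upper triangular entries row by row). The smoothed Schatten $p$-norm (raised to the power $p$) of a matrix $X$ with singular values $\sigma_i$ is $\sum_{i}(\sigma_i^2+\varepsilon)^{p/2}=\operatorname{tr}(X^{T}X+\varepsilon I)^{p/2}$, so $f$ is this quantity expressed in the vector parametrization. $\nabla f$ is the ordinary gradient of $f:\mathbb{R}^{n(n-1)/2}\to\mathbb{R}$ with respect to the vector variable. *)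

theory Defs
  imports "HOL-Analysis.Analysis"
begin

text \<open>Positive semidefiniteness includes symmetry.\<close>

definition psd :: "real^'n^'n \<Rightarrow> bool" where
  "psd A \<longleftrightarrow> transpose A = A \<and> (\<forall>v. 0 \<le> v \<bullet> (A *v v))"

definition diag_mat :: "real^'n \<Rightarrow> real^'n^'n" where
  "diag_mat d = (\<chi> i j. if i = j then d $ i else 0)"

text \<open>
  Real power of a symmetric positive semidefinite matrix, through an orthogonal
  diagonalisation \<open>A = U diag(d) U\<^sup>T\<close>; the result does not depend on the choice of
  \<open>U\<close> and \<open>d\<close>. Nothing is claimed about other matrices.
\<close>

definition mat_powr :: "real^'n^'n \<Rightarrow> real \<Rightarrow> real^'n^'n" where
  "mat_powr A s = (THE B. \<exists>U d. orthogonal_matrix U \<and>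
      A = U ** diag_mat d ** transpose U \<and>
      B = U ** diag_mat (\<chi> i. d $ i powr s) ** transpose U)"

definition gradient :: "('a::real_inner \<Rightarrow> real) \<Rightarrow> 'a \<Rightarrow> 'a" where
  "gradient f x = (THE g. GDERIV f x :> g)"

text \<open>
  The 1-based position of an element of a finite linearly ordered index type, so that
  coordinates \<open>1, \<dots>, n\<close> can be addressed by number.
\<close>

definition position :: "'a::{finite,linorder} \<Rightarrow> nat" where
  "position i = card {k. k \<le> i}"

lemma bij_betw_position:
  "bij_betw (position :: 'a::{finite,linorder} \<Rightarrow> nat) UNIV {1..CARD('a)}"
proof -
  have less: "position a < position b" if "a < b" for a b :: 'a
  proof -
    have "{k. k \<le> a} \<subset> {k. k \<le> b}"
      using that by (auto simp: psubset_eq set_eq_iff not_le intro: exI[of _ b])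
    then show ?thesis
      unfolding position_def by (intro psubset_card_mono) auto
  qed
  have inj: "inj (position :: 'a \<Rightarrow> nat)"
    by (rule injI) (metis less less_irrefl neq_iff)
  have "position i \<in> {1..CARD('a)}" for i :: 'a
    unfolding position_def by (auto simp: Suc_le_eq card_gt_0_iff intro: card_mono)
  then have "range (position :: 'a \<Rightarrow> nat) \<subseteq> {1..CARD('a)}"
    by auto
  moreover have "card (range (position :: 'a \<Rightarrow> nat)) = card {1..CARD('a)}"
    using inj by (simp add: card_image)
  ultimately have "range (position :: 'a \<Rightarrow> nat) = {1..CARD('a)}"
    by (intro card_subset_eq) auto
  with inj show ?thesis
    by (simp add: bij_betw_def)
qed

text \<open>
  Row-by-row number of the entry \<open>(i, j)\<close> of the strict upper triangle. For \<open>i < j\<close> the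
  natural-number subtractions do not truncate.
\<close>

definition upper_index :: "'n::{finite,linorder} \<Rightarrow> 'n \<Rightarrow> nat" where
  "upper_index i j =
    (\<Sum>k = 1..position i - 1. CARD('n) - k) + position j - position i"

text \<open>
  The matrix \<open>X(y)\<close>, meaningful if \<open>CARD('m) = CARD('n) * (CARD('n) - 1) div 2\<close>.
\<close>

definition unit_diag_mat ::
  "real^('m::{finite,linorder}) \<Rightarrow> real^('n::{finite,linorder})^('n::{finite,linorder})" where
  "unit_diag_mat y = (\<chi> i j. if i = j then 1
      else y $ (THE d. position d = upper_index (min i j) (max i j)))"

text \<open>The \<open>p\<close>-th power of the smoothed Schatten \<open>p\<close>-norm.\<close>

definition smoothed_schatten :: "real \<Rightarrow> real \<Rightarrow> real^'n^'n \<Rightarrow> real" where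
  "smoothed_schatten \<epsilon> p A =
    trace (mat_powr (transpose A ** A + \<epsilon> *\<^sub>R mat 1) (p / 2))"

end

theory Submission
  imports Defs
begin

text \<open>
  With \<open>\<phi>(t) = (t\<^sup>2 + \<epsilon>) powr (p / 2)\<close> the objective is the sum of \<open>\<phi>\<close> over the eigenvalues of
  \<open>X(y)\<close>. If \<open>s\<^sub>i, u\<^sub>i\<close> and \<open>t\<^sub>j, v\<^sub>j\<close> are eigenpairs of \<open>A\<close> and \<open>B\<close>, the remainder
  \<open>\<Sum>\<phi>(t\<^sub>j) - \<Sum>\<phi>(s\<^sub>i) - tr(\<phi>'(A)(B - A))\<close> equals the double sum of
  \<open>(u\<^sub>i \<bullet> v\<^sub>j)\<^sup>2 (\<phi>(t\<^sub>j) - \<phi>(s\<^sub>i) - \<phi>'(s\<^sub>i)(t\<^sub>j - s\<^sub>i))\<close>, which is quadratic in \<open>B - A\<close>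
  because \<open>\<phi>''\<close> is bounded. So the gradient exists and its entries are \<open>2 W\<^sub>i\<^sub>j\<close> with
  \<open>W = \<phi>'(X(x))\<close>. The gradient step is therefore \<open>(X(x) - 2\<alpha>W) + 2\<alpha> diag(W)\<close>; both summands are
  positive semidefinite, since \<open>0 \<le> 2\<alpha>\<phi>'(s) \<le> s\<close> for \<open>s \<ge> 0\<close>.
\<close>

section \<open>Spectral theorem for real symmetric matrices\<close>

text \<open>The quadratic form \<open>x \<bullet> T x\<close> attains its maximum on the compact
  unit sphere of \<open>S\<close>, and a maximiser is an eigenvector: the residual
  \<open>c *\<^sub>R v - T v\<close> lies in \<open>S\<close> by invariance and is orthogonal to all
  of \<open>S\<close> by the variational argument.\<close>

lemma self_adjoint_eigenvector:
  fixes T :: "'a::euclidean_space \<Rightarrow> 'a"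
  assumes lin: "linear T" and sa: "\<And>x y. T x \<bullet> y = x \<bullet> T y"
    and S: "subspace S" and inv: "T ` S \<subseteq> S" and nz: "S \<noteq> {0}"
  obtains v c where "v \<in> S" "norm v = 1" "T v = c *\<^sub>R v"
proof -
  let ?K = "S \<inter> sphere 0 1"
  obtain w where w: "w \<in> S" "w \<noteq> 0"
    using nz S subspace_0 by blast
  have "(1 / norm w) *\<^sub>R w \<in> ?K"
    using w S by (simp add: subspace_scale)
  then have ne: "?K \<noteq> {}" by blast
  have "compact ?K"
    using closed_subspace[OF S] compact_Int_closed[of "sphere 0 1" S] by (simp add: Int_commute)
  moreover have "continuous_on ?K (\<lambda>x. x \<bullet> T x)"
    using linear_continuous_on[OF linear_conv_bounded_linear[THEN iffD1, OF lin]]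
    by (intro continuous_intros) auto
  ultimately obtain v where v: "v \<in> ?K" and max: "\<And>x. x \<in> ?K \<Longrightarrow> x \<bullet> T x \<le> v \<bullet> T v"
    using continuous_attains_sup[OF _ ne] by metis
  define c where "c = v \<bullet> T v"
  have vS: "v \<in> S" and nv: "v \<bullet> v = 1"
    using v by (auto simp: norm_eq_1)
  define q where "q = (\<lambda>x. c * (x \<bullet> x) - x \<bullet> T x)"
  have q_nonneg: "0 \<le> q x" if "x \<in> S" for x
  proof (cases "x = 0")
    case True
    then show ?thesis by (simp add: q_def)
  next
    case False
    let ?y = "(1 / norm x) *\<^sub>R x"
    have "?y \<in> ?K" using that False S by (simp add: subspace_scale)
    then have "?y \<bullet> T ?y \<le> c" using max c_def by blast
    then have "(x \<bullet> T x) / (norm x)\<^sup>2 \<le> c"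
      by (simp add: linear_scale[OF lin] power2_eq_square)
    then show ?thesis using False
      by (simp add: q_def field_simps power2_norm_eq_inner)
  qed
  \<comment> \<open>\<open>q\<close> is minimal on \<open>S\<close> at \<open>v\<close>, so its first variation there vanishes.\<close>
  have orth: "w \<bullet> (c *\<^sub>R v - T v) = 0" if w: "w \<in> S" for w
  proof -
    define b where "b = w \<bullet> (c *\<^sub>R v - T v)"
    have expand: "q (v + t *\<^sub>R w) = 2 * t * b + t\<^sup>2 * q w" for t
    proof -
      have "v \<bullet> T w = w \<bullet> T v" by (metis sa inner_commute)
      then show ?thesis
        by (simp add: q_def b_def linear_add[OF lin] linear_scale[OF lin] inner_simps nv
            inner_commute[of v w] c_def[symmetric] power2_eq_square algebra_simps)
    qed
    have nn: "0 \<le> 2 * t * b + t\<^sup>2 * q w" for t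
      using q_nonneg[of "v + t *\<^sub>R w"] w vS S expand
      by (simp add: subspace_add subspace_scale)
    have qw: "0 \<le> q w" using q_nonneg w by blast
    \<comment> \<open>The minimiser of the parabola would be \<open>- b / q w\<close>, but
      \<open>q w\<close> may vanish. Adding 1 to the denominator keeps it positive, and the value is
      still negative unless \<open>b = 0\<close>.\<close>
    let ?t = "- b / (1 + q w)"
    have "2 * ?t * b + ?t\<^sup>2 * q w = - (b\<^sup>2 * (2 + q w)) / (1 + q w)\<^sup>2"
      using qw by (simp add: divide_simps power2_eq_square) algebra
    then have "0 \<le> - (b\<^sup>2 * (2 + q w)) / (1 + q w)\<^sup>2" using nn[of ?t] by simp
    then have "b\<^sup>2 * (2 + q w) \<le> 0" using qw by (simp add: divide_simps split: if_splits)
    moreover have "0 \<le> b\<^sup>2 * q w" using qw by simp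
    ultimately have "b\<^sup>2 \<le> 0" unfolding distrib_left by linarith
    then show ?thesis by (simp only: b_def power2_less_eq_zero_iff)
  qed
  have "c *\<^sub>R v - T v \<in> S"
    using vS S inv by (auto intro!: subspace_diff subspace_scale)
  then have "c *\<^sub>R v - T v = 0"
    using orth inner_eq_zero_iff by blast
  then show ?thesis
    using that[of v c] v by simp
qed

text \<open>Induction on the dimension: a unit eigenvector \<open>v\<close> is split off, and
  self-adjointness makes the orthogonal complement of \<open>v\<close> inside \<open>S\<close>
  invariant again.\<close>

lemma self_adjoint_orthonormal_eigenbasis:
  fixes T :: "'a::euclidean_space \<Rightarrow> 'a"
  assumes lin: "linear T" and sa: "\<And>x y. T x \<bullet> y = x \<bullet> T y"
  shows "subspace S \<Longrightarrow> T ` S \<subseteq> S \<Longrightarrow>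
    \<exists>B. B \<subseteq> S \<and> pairwise orthogonal B \<and> (\<forall>b\<in>B. norm b = 1 \<and> (\<exists>c. T b = c *\<^sub>R b)) \<and> span B = S"
proof (induction "dim S" arbitrary: S rule: less_induct)
  case (less S)
  show ?case
  proof (cases "S = {0}")
    case True
    then show ?thesis by (intro exI[of _ "{}"]) auto
  next
    case False
    obtain v c where v: "v \<in> S" "norm v = 1" "T v = c *\<^sub>R v"
      using self_adjoint_eigenvector[OF lin sa less.prems False] by metis
    have vv: "v \<bullet> v = 1" using v by (simp add: norm_eq_1)
    let ?S = "S \<inter> {x. v \<bullet> x = 0}"
    have sub: "subspace ?S"
      using less.prems(1) subspace_hyperplane by (rule subspace_inter)
    have "v \<notin> ?S" using vv by simp
    then have "?S \<subset> S" using v(1) by blast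
    then have "span ?S \<subset> span S"
      using sub less.prems(1) by (simp only: span_eq_iff[THEN iffD2])
    then have "dim ?S < dim S" by (rule dim_psubset)
    moreover have "T ` ?S \<subseteq> ?S"
    proof -
      have "v \<bullet> T x = 0" if "v \<bullet> x = 0" for x
        using sa[of v x] that v by simp
      then show ?thesis using less.prems(2) by auto
    qed
    ultimately obtain B where B: "B \<subseteq> ?S" "pairwise orthogonal B"
      "\<forall>b\<in>B. norm b = 1 \<and> (\<exists>c. T b = c *\<^sub>R b)" "span B = ?S"
      using less.hyps[OF _ sub] by blast
    have "S \<subseteq> span (insert v B)"
    proof
      fix x assume x: "x \<in> S"
      have "x - (v \<bullet> x) *\<^sub>R v \<in> ?S"
        using x v(1) less.prems(1) vv by (auto simp: inner_simps intro!: subspace_diff subspace_scale)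
      then show "x \<in> span (insert v B)"
        using B(4) span_breakdown_eq by blast
    qed
    moreover have "span (insert v B) \<subseteq> S"
      using B(1) v(1) less.prems(1) by (intro span_minimal) auto
    moreover have "pairwise orthogonal (insert v B)"
      using B(1,2) by (auto simp: pairwise_insert orthogonal_def inner_commute)
    ultimately show ?thesis
      using B(1,3) v by (intro exI[of _ "insert v B"]) auto
  qed
qed

lemma diag_mat_mult_nth:
  "(diag_mat d ** M) $ i $ j = d $ i * M $ i $ j"
  "(M ** diag_mat d) $ i $ j = M $ i $ j * d $ j"
  by (simp_all add: matrix_matrix_mult_def diag_mat_def if_distrib if_distribR cong: if_cong)

text \<open>An orthonormal eigenbasis of the whole space has \<open>CARD('n)\<close> elements, so it
  can be indexed by \<open>'n\<close> and used as the columns of \<open>U\<close>. The eigenvector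
  equations, read column by column, then say \<open>A ** U = U ** diag_mat d\<close>.\<close>

lemma symmetric_orthogonal_diagonalisation:
  fixes A :: "real^'n^'n"
  assumes "transpose A = A"
  obtains U d where "orthogonal_matrix U" "A = U ** diag_mat d ** transpose U"
proof -
  have sa: "(A *v x) \<bullet> y = x \<bullet> (A *v y)" for x y
    by (metis assms dot_lmul_matrix vector_transpose_matrix)
  obtain B where orth: "pairwise orthogonal B"
    and B: "\<forall>b\<in>B. norm b = 1 \<and> (\<exists>c. A *v b = c *\<^sub>R b)" and spanB: "span B = UNIV"
    using self_adjoint_orthonormal_eigenbasis[OF matrix_vector_mul_linear sa, of UNIV] by auto
  have "0 \<notin> B" using B by fastforce
  then have ind: "independent B"
    using orth pairwise_orthogonal_independent by blast
  then have fin: "finite B" by (rule independent_imp_finite)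
  have "card B = CARD('n)"
    using dim_span_eq_card_independent[OF ind] spanB by simp
  then obtain u :: "'n \<Rightarrow> real^'n" where u: "bij_betw u UNIV B"
    using fin finite_same_card_bij[of "UNIV :: 'n set" B] by auto
  have uB: "u i \<in> B" for i using bij_betwE[OF u] by simp
  have "\<exists>c. A *v u i = c *\<^sub>R u i" for i using bspec[OF B uB] by simp
  then obtain d where d: "\<And>i. A *v u i = d i *\<^sub>R u i" by metis
  define U :: "real^'n^'n" where "U = (\<chi> k i. u i $ k)"
  have col: "column i U = u i" for i
    by (simp add: column_def U_def vec_eq_iff)
  have inj: "u i = u j \<longleftrightarrow> i = j" for i j
    using bij_betw_imp_inj_on[OF u] by (rule inj_eq)
  have "orthogonal (u i) (u j)" if "i \<noteq> j" for i j
    using pairwiseD[OF orth uB uB] that inj by blast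
  then have U: "orthogonal_matrix U"
    using B uB by (simp add: orthogonal_matrix_orthonormal_columns col)
  have "A ** U = U ** diag_mat (\<chi> i. d i)"
  proof -
    have "(A ** U) $ k $ i = (U ** diag_mat (\<chi> i. d i)) $ k $ i" for k i
    proof -
      have "(A ** U) $ k $ i = (A *v u i) $ k"
        by (simp add: matrix_matrix_mult_def matrix_vector_mult_def U_def)
      also have "\<dots> = (U ** diag_mat (\<chi> i. d i)) $ k $ i"
        by (simp add: d diag_mat_mult_nth U_def)
      finally show ?thesis .
    qed
    then show ?thesis by (simp add: vec_eq_iff)
  qed
  then have "A = U ** diag_mat (\<chi> i. d i) ** transpose U"
    using U by (metis matrix_mul_assoc matrix_mul_rid orthogonal_matrix_def)
  with U show ?thesis using that by blast
qed

section \<open>Functions of symmetric matrices and the objective as a spectral sum\<close>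

text \<open>Two diagonalisations agree iff \<open>Q = transpose V ** U\<close> intertwines the
  diagonals, that is \<open>Q $ i $ j * d $ j = e $ i * Q $ i $ j\<close>. So
  \<open>Q $ i $ j\<close> vanishes unless \<open>d $ j = e $ i\<close>, and in that case the values
  of \<open>g\<close> agree too. This is what makes the description in \<open>mat_powr\<close> well
  defined.\<close>

lemma spectral_calculus_unique:
  fixes U V :: "real^'n^'n" and g :: "real \<Rightarrow> real"
  assumes U: "orthogonal_matrix U" and V: "orthogonal_matrix V"
    and eq: "U ** diag_mat d ** transpose U = V ** diag_mat e ** transpose V"
  shows "U ** diag_mat (\<chi> i. g (d $ i)) ** transpose U =
    V ** diag_mat (\<chi> i. g (e $ i)) ** transpose V"
proof -
  define Q where "Q = transpose V ** U"
  note ort = U[unfolded orthogonal_matrix_def] V[unfolded orthogonal_matrix_def]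
  \<comment> \<open>Stated for arbitrary diagonals, since it is applied to the given ones and then,
    in the other direction, to their images under \<open>g\<close>.\<close>
  have conj: "U ** diag_mat d ** transpose U = V ** diag_mat e ** transpose V \<longleftrightarrow>
      Q ** diag_mat d = diag_mat e ** Q" for d e
  proof
    assume "U ** diag_mat d ** transpose U = V ** diag_mat e ** transpose V"
    then have "transpose V ** (U ** diag_mat d ** transpose U) ** U =
        transpose V ** (V ** diag_mat e ** transpose V) ** U" by simp
    then show "Q ** diag_mat d = diag_mat e ** Q"
      unfolding Q_def using ort by (metis matrix_mul_assoc matrix_mul_lid matrix_mul_rid)
  next
    assume "Q ** diag_mat d = diag_mat e ** Q"
    then have "V ** (Q ** diag_mat d) ** transpose U = V ** (diag_mat e ** Q) ** transpose U"
      by simp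
    then show "U ** diag_mat d ** transpose U = V ** diag_mat e ** transpose V"
      unfolding Q_def using ort by (metis matrix_mul_assoc matrix_mul_lid matrix_mul_rid)
  qed
  have "Q $ i $ j * d $ j = e $ i * Q $ i $ j" for i j
    using eq[unfolded conj] by (metis diag_mat_mult_nth)
  then have "Q $ i $ j * g (d $ j) = g (e $ i) * Q $ i $ j" for i j
    by (metis mult.commute mult_cancel_right)
  then show ?thesis
    unfolding conj by (simp add: vec_eq_iff diag_mat_mult_nth)
qed

lemma mat_powr_diagonalised:
  assumes "orthogonal_matrix U"
  shows "mat_powr (U ** diag_mat d ** transpose U) s =
    U ** diag_mat (\<chi> i. d $ i powr s) ** transpose U"
  unfolding mat_powr_def
proof (rule the_equality, goal_cases)
  case 1
  show ?case using assms by blast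
next
  case (2 B)
  then show ?case
    using spectral_calculus_unique[OF _ assms, where g = "\<lambda>x. x powr s"] by metis
qed

lemma trace_orthogonal_conj:
  assumes "orthogonal_matrix U"
  shows "trace (U ** diag_mat d ** transpose U) = (\<Sum>i\<in>UNIV. d $ i)"
proof -
  have "trace (U ** diag_mat d ** transpose U) = trace (transpose U ** (U ** diag_mat d))"
    by (rule trace_mul_sym)
  also have "\<dots> = trace (diag_mat d)"
    using assms by (simp add: matrix_mul_assoc orthogonal_matrix_def)
  finally show ?thesis by (simp add: trace_def diag_mat_def)
qed

lemma matrix_add_rdistrib_real:
  fixes A B :: "real^'n^'m"
  shows "(A + B) ** C = A ** C + B ** C"
  by (simp add: vec_eq_iff matrix_matrix_mult_def distrib_right sum.distrib)

lemma smoothed_schatten_diagonalised: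
  fixes A :: "real^'n^'n"
  assumes U: "orthogonal_matrix U" and A: "A = U ** diag_mat d ** transpose U"
  shows "smoothed_schatten \<epsilon> p A = (\<Sum>i\<in>UNIV. ((d $ i)\<^sup>2 + \<epsilon>) powr (p / 2))"
proof -
  note UU = U[unfolded orthogonal_matrix_def]
  have "transpose (diag_mat d) = diag_mat d"
    by (auto simp: diag_mat_def transpose_def vec_eq_iff)
  then have "transpose A ** A = U ** (diag_mat d ** (transpose U ** U) ** diag_mat d) ** transpose U"
    by (simp add: A matrix_transpose_mul matrix_mul_assoc)
  also have "\<dots> = U ** diag_mat (\<chi> i. (d $ i)\<^sup>2) ** transpose U"
  proof -
    have "diag_mat d ** diag_mat d = diag_mat (\<chi> i. (d $ i)\<^sup>2)"
      by (auto simp: vec_eq_iff diag_mat_mult_nth) (auto simp: diag_mat_def power2_eq_square)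
    then show ?thesis using UU by simp
  qed
  also have "\<dots> + \<epsilon> *\<^sub>R mat 1 = U ** diag_mat (\<chi> i. (d $ i)\<^sup>2 + \<epsilon>) ** transpose U"
  proof -
    have "diag_mat (\<chi> i. (d $ i)\<^sup>2 + \<epsilon>) = diag_mat (\<chi> i. (d $ i)\<^sup>2) + \<epsilon> *\<^sub>R mat 1"
      by (auto simp: vec_eq_iff diag_mat_def mat_def)
    moreover have "\<epsilon> *\<^sub>R mat 1 = U ** (\<epsilon> *\<^sub>R mat 1) ** transpose U"
      using UU by (metis matrix_mul_rid scalar_matrix_assoc matrix_scalar_ac scalar_mult_eq_scaleR)
    ultimately show ?thesis
      by (simp add: matrix_add_ldistrib matrix_add_rdistrib_real)
  qed
  finally show ?thesis
    unfolding smoothed_schatten_def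
    by (simp add: mat_powr_diagonalised[OF U] trace_orthogonal_conj[OF U])
qed

section \<open>Scalar Taylor estimates\<close>

text \<open>The mean value bound is used twice: on \<open>g'\<close>, and then on
  \<open>g t - g' a * t\<close>, whose derivative is \<open>g' t - g' a\<close>. This gives
  \<open>C\<close> instead of the sharp \<open>C / 2\<close>, which suffices because only the
  quadratic order matters for differentiability.\<close>

lemma taylor_remainder_le_square:
  fixes g g' g'' :: "real \<Rightarrow> real"
  assumes g: "\<And>t. (g has_field_derivative g' t) (at t)"
    and g': "\<And>t. (g' has_field_derivative g'' t) (at t)"
    and bound: "\<And>t. \<bar>g'' t\<bar> \<le> C"
  shows "\<bar>g b - g a - g' a * (b - a)\<bar> \<le> C * (b - a)\<^sup>2"
proof -
  have C: "0 \<le> C" using bound[of 0] by linarith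
  let ?S = "closed_segment a b"
  have "norm ((g b - g' a * b) - (g a - g' a * a)) \<le> (C * \<bar>b - a\<bar>) * norm (b - a)"
  proof (rule field_differentiable_bound[where S = ?S and f = "\<lambda>t. g t - g' a * t"])
    show "convex ?S" by simp
    show "((\<lambda>t. g t - g' a * t) has_field_derivative g' t - g' a) (at t within ?S)" for t
      by (auto intro!: derivative_eq_intros has_field_derivative_at_within[OF g])
    fix t assume t: "t \<in> ?S"
    have "norm (g' t - g' a) \<le> C * norm (t - a)"
      by (rule field_differentiable_bound[where S = UNIV and f' = g''])
        (use g' bound in \<open>auto intro: has_field_derivative_at_within\<close>)
    also have "\<dots> \<le> C * \<bar>b - a\<bar>"
      using t C by (intro mult_left_mono) (auto simp: closed_segment_eq_real_ivl split: if_splits)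
    finally show "norm (g' t - g' a) \<le> C * \<bar>b - a\<bar>" .
  qed auto
  then show ?thesis by (simp add: algebra_simps power2_eq_square abs_mult_self_eq)
qed

lemma smoothed_power_derivative:
  assumes "\<epsilon> > (0::real)"
  shows "((\<lambda>t. (t\<^sup>2 + \<epsilon>) powr q) has_field_derivative 2 * q * t * (t\<^sup>2 + \<epsilon>) powr (q - 1)) (at t)"
proof -
  have "0 < t\<^sup>2 + \<epsilon>" using assms by (simp add: add_nonneg_pos)
  then show ?thesis
    by (auto intro!: derivative_eq_intros simp: powr_diff)
qed

text \<open>With \<open>q = p / 2 - 1\<close> in \<open>[-1, 0]\<close> and
  \<open>r = t\<^sup>2 + \<epsilon>\<close>, monotonicity gives
  \<open>r powr q \<le> \<epsilon> powr q\<close>. Of the factor 3, one part bounds the first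
  summand of the second derivative and two parts bound the second, through
  \<open>\<bar>q\<bar> \<le> 1\<close> and \<open>t\<^sup>2 \<le> r\<close>.\<close>

lemma smoothed_power_taylor:
  fixes \<epsilon> p a b :: real
  assumes \<epsilon>: "\<epsilon> > 0" and p: "0 < p" "p \<le> 2"
  shows "\<bar>(b\<^sup>2 + \<epsilon>) powr (p / 2) - (a\<^sup>2 + \<epsilon>) powr (p / 2)
      - p * a * (a\<^sup>2 + \<epsilon>) powr (p / 2 - 1) * (b - a)\<bar>
    \<le> 3 * p * \<epsilon> powr (p / 2 - 1) * (b - a)\<^sup>2"
proof (rule taylor_remainder_le_square[where g'' =
      "\<lambda>t. p * (t\<^sup>2 + \<epsilon>) powr (p / 2 - 1)
        + p * t * (2 * (p / 2 - 1) * t * (t\<^sup>2 + \<epsilon>) powr (p / 2 - 1 - 1))"])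
  fix t :: real
  show "((\<lambda>t. (t\<^sup>2 + \<epsilon>) powr (p / 2)) has_field_derivative
      p * t * (t\<^sup>2 + \<epsilon>) powr (p / 2 - 1)) (at t)"
    using smoothed_power_derivative[OF \<epsilon>, of "p / 2" t] by simp
  show "((\<lambda>t. p * t * (t\<^sup>2 + \<epsilon>) powr (p / 2 - 1)) has_field_derivative
      p * (t\<^sup>2 + \<epsilon>) powr (p / 2 - 1)
        + p * t * (2 * (p / 2 - 1) * t * (t\<^sup>2 + \<epsilon>) powr (p / 2 - 1 - 1))) (at t)"
    by (rule derivative_eq_intros smoothed_power_derivative[OF \<epsilon>] refl | simp)+
  define r where "r = t\<^sup>2 + \<epsilon>"
  define q where "q = p / 2 - 1"
  have r: "0 < r" "\<epsilon> \<le> r" "t\<^sup>2 \<le> r" using \<epsilon> by (auto simp: r_def add_nonneg_pos)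
  have q: "-1 \<le> q" "q \<le> 0" using p by (auto simp: q_def)
  have le: "r powr q \<le> \<epsilon> powr q" using r \<epsilon> q by (intro powr_mono2') auto
  have "t\<^sup>2 * r powr (q - 1) \<le> r * r powr (q - 1)" using r by (intro mult_right_mono) auto
  also have "\<dots> = r powr q" using r by (simp add: powr_diff)
  finally have t2: "t\<^sup>2 * r powr (q - 1) \<le> \<epsilon> powr q" using le by linarith
  have "\<bar>p * t * (2 * q * t * r powr (q - 1))\<bar> = 2 * p * (\<bar>q\<bar> * (t\<^sup>2 * r powr (q - 1)))"
    using p by (simp add: abs_mult power2_eq_square)
  also have "\<dots> \<le> 2 * p * (1 * \<epsilon> powr q)"
    using p q t2 by (intro mult_left_mono mult_mono) auto
  finally have 1: "\<bar>p * t * (2 * q * t * r powr (q - 1))\<bar> \<le> 2 * p * \<epsilon> powr q" by simp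
  have 2: "\<bar>p * r powr q\<bar> \<le> p * \<epsilon> powr q" using p le by (simp add: abs_mult)
  have "\<bar>p * r powr q + p * t * (2 * q * t * r powr (q - 1))\<bar> \<le> 3 * p * \<epsilon> powr q"
    using 1 2 by linarith
  then show "\<bar>p * (t\<^sup>2 + \<epsilon>) powr (p / 2 - 1)
      + p * t * (2 * (p / 2 - 1) * t * (t\<^sup>2 + \<epsilon>) powr (p / 2 - 1 - 1))\<bar>
      \<le> 3 * p * \<epsilon> powr (p / 2 - 1)"
    by (simp add: r_def q_def)
qed

section \<open>Second-order expansion of spectral sums\<close>

lemma orthogonal_matrix_abs_entry_le_1:
  fixes U :: "real^'n^'n"
  assumes "orthogonal_matrix U"
  shows "\<bar>U $ i $ j\<bar> \<le> 1"
  using component_le_norm_cart[of "column j U" i] assms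
  by (simp add: orthogonal_matrix_orthonormal_columns column_def)

lemma orthogonal_matrix_sum_squares:
  fixes Q :: "real^'n^'n"
  assumes "orthogonal_matrix Q"
  shows "(\<Sum>j\<in>UNIV. (Q $ i $ j)\<^sup>2) = 1" "(\<Sum>i\<in>UNIV. (Q $ i $ j)\<^sup>2) = 1"
proof -
  have "(Q ** transpose Q) $ i $ i = 1" "(transpose Q ** Q) $ j $ j = 1"
    using assms by (simp_all add: orthogonal_matrix_def mat_def)
  then show "(\<Sum>j\<in>UNIV. (Q $ i $ j)\<^sup>2) = 1" "(\<Sum>i\<in>UNIV. (Q $ i $ j)\<^sup>2) = 1"
    by (simp_all add: matrix_matrix_mult_def transpose_def power2_eq_square)
qed

lemma matrix_diff_distrib:
  fixes A B :: "real^'n^'m"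
  shows "(A - B) ** C = A ** C - B ** C" "D ** (A - B) = D ** A - D ** B"
  by (simp_all add: vec_eq_iff matrix_matrix_mult_def algebra_simps sum_subtractf)

text \<open>The squares of the entries of \<open>Q\<close> form a doubly stochastic matrix, so each
  single sum over eigenvalues spreads into a double sum with weights
  \<open>(Q $ i $ j)\<^sup>2\<close>. No continuity of eigenvalues or eigenvectors is needed. The
  power 6 comes from \<open>n\<^sup>2\<close> pairs, each contributing the square of an entry bound
  \<open>n\<^sup>2 * e\<close>.\<close>

lemma spectral_sum_remainder:
  fixes U V :: "real^'n^'n" and g g' :: "real \<Rightarrow> real"
  assumes U: "orthogonal_matrix U" and V: "orthogonal_matrix V"
    and A: "A = U ** diag_mat s ** transpose U" and B: "B = V ** diag_mat t ** transpose V"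
    and taylor: "\<And>a b. \<bar>g b - g a - g' a * (b - a)\<bar> \<le> C * (b - a)\<^sup>2"
    and small: "\<And>k l. \<bar>(B - A) $ k $ l\<bar> \<le> e"
  shows "\<bar>(\<Sum>j\<in>UNIV. g (t $ j)) - (\<Sum>i\<in>UNIV. g (s $ i))
      - trace (U ** diag_mat (\<chi> i. g' (s $ i)) ** transpose U ** (B - A))\<bar>
    \<le> C * real CARD('n) ^ 6 * e\<^sup>2"
proof -
  define Q where "Q = transpose U ** V"
  note UU = U[unfolded orthogonal_matrix_def] and VV = V[unfolded orthogonal_matrix_def]
  have Q: "orthogonal_matrix Q"
    using U V unfolding Q_def by (simp add: orthogonal_matrix_mul orthogonal_matrix_transpose)
  note rows = orthogonal_matrix_sum_squares(1)[OF Q] and cols = orthogonal_matrix_sum_squares(2)[OF Q]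
  have conjB: "transpose U ** B ** U = Q ** diag_mat t ** transpose Q"
    by (simp add: B Q_def matrix_transpose_mul matrix_mul_assoc)
  have conjA: "transpose U ** A ** U = diag_mat s"
    using UU unfolding A by (metis matrix_mul_assoc matrix_mul_lid matrix_mul_rid)
  have diag: "(transpose U ** (B - A) ** U) $ i $ i = (\<Sum>j\<in>UNIV. (Q $ i $ j)\<^sup>2 * (t $ j - s $ i))" for i
  proof -
    have "(Q ** diag_mat t ** transpose Q) $ i $ i = (\<Sum>j\<in>UNIV. (Q $ i $ j)\<^sup>2 * t $ j)"
      by (subst matrix_matrix_mult_def)
        (simp add: diag_mat_mult_nth transpose_def power2_eq_square mult_ac)
    moreover have "diag_mat s $ i $ i = (\<Sum>j\<in>UNIV. (Q $ i $ j)\<^sup>2 * s $ i)"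
      by (simp add: diag_mat_def rows flip: sum_distrib_right)
    ultimately show ?thesis
      by (simp add: matrix_diff_distrib conjA conjB right_diff_distrib sum_subtractf)
  qed
  \<comment> \<open>Using the eigenbasis of \<open>A\<close> on the left and that of
    \<open>B\<close> on the right turns the weighted gap \<open>Q $ i $ j * (t $ j - s $ i)\<close>
    into an entry of a rotated \<open>B - A\<close>, so it is small even where the eigenvalues
    themselves are far apart.\<close>
  have off: "(transpose U ** (B - A) ** V) $ i $ j = Q $ i $ j * (t $ j - s $ i)" for i j
  proof -
    have "transpose U ** B ** V = Q ** diag_mat t"
      using VV unfolding B Q_def by (metis matrix_mul_assoc matrix_mul_rid)
    moreover have "transpose U ** A ** V = diag_mat s ** Q"
      using UU unfolding A Q_def by (metis matrix_mul_assoc matrix_mul_lid)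
    ultimately show ?thesis
      by (simp add: matrix_diff_distrib diag_mat_mult_nth algebra_simps)
  qed
  \<comment> \<open>Any pair of indices would do; \<open>undefined\<close> merely names one.\<close>
  have e: "0 \<le> e" using small[of undefined undefined] by linarith
  have off_le: "\<bar>Q $ i $ j * (t $ j - s $ i)\<bar> \<le> real CARD('n) ^ 2 * e" for i j
  proof -
    have "\<bar>(transpose U ** (B - A) ** V) $ i $ j\<bar>
        = \<bar>\<Sum>l\<in>UNIV. \<Sum>k\<in>UNIV. U $ k $ i * (B - A) $ k $ l * V $ l $ j\<bar>"
      by (simp add: matrix_matrix_mult_def transpose_def sum_distrib_right)
    also have "\<dots> \<le> (\<Sum>l\<in>UNIV. \<bar>\<Sum>k\<in>UNIV. U $ k $ i * (B - A) $ k $ l * V $ l $ j\<bar>)"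
      by (rule sum_abs)
    also have "\<dots> \<le> (\<Sum>l\<in>(UNIV::'n set). \<Sum>k\<in>(UNIV::'n set). e)"
    proof (intro sum_mono order.trans[OF sum_abs])
      fix k l
      have "\<bar>U $ k $ i\<bar> * \<bar>(B - A) $ k $ l\<bar> * \<bar>V $ l $ j\<bar> \<le> 1 * e * 1"
        using small e orthogonal_matrix_abs_entry_le_1[OF U] orthogonal_matrix_abs_entry_le_1[OF V]
        by (intro mult_mono) auto
      then show "\<bar>U $ k $ i * (B - A) $ k $ l * V $ l $ j\<bar> \<le> e"
        by (simp add: abs_mult)
    qed
    finally show ?thesis by (simp add: off power2_eq_square mult.assoc)
  qed
  have C: "0 \<le> C" using taylor[of 1 0] by simp
  have "trace (U ** diag_mat (\<chi> i. g' (s $ i)) ** transpose U ** (B - A))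
      = trace (diag_mat (\<chi> i. g' (s $ i)) ** (transpose U ** (B - A) ** U))"
    by (metis matrix_mul_assoc trace_mul_sym)
  also have "\<dots> = (\<Sum>i\<in>UNIV. \<Sum>j\<in>UNIV. (Q $ i $ j)\<^sup>2 * (g' (s $ i) * (t $ j - s $ i)))"
    by (simp add: trace_def diag_mat_mult_nth diag sum_distrib_left mult_ac)
  finally have tr: "trace (U ** diag_mat (\<chi> i. g' (s $ i)) ** transpose U ** (B - A))
      = (\<Sum>i\<in>UNIV. \<Sum>j\<in>UNIV. (Q $ i $ j)\<^sup>2 * (g' (s $ i) * (t $ j - s $ i)))" .
  have gs: "(\<Sum>i\<in>UNIV. g (s $ i)) = (\<Sum>i\<in>UNIV. \<Sum>j\<in>UNIV. (Q $ i $ j)\<^sup>2 * g (s $ i))"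
    by (simp add: rows flip: sum_distrib_right)
  have gt: "(\<Sum>j\<in>UNIV. g (t $ j)) = (\<Sum>i\<in>UNIV. \<Sum>j\<in>UNIV. (Q $ i $ j)\<^sup>2 * g (t $ j))"
    by (subst sum.swap) (simp add: cols flip: sum_distrib_right)
  have "\<bar>(\<Sum>j\<in>UNIV. g (t $ j)) - (\<Sum>i\<in>UNIV. g (s $ i))
      - trace (U ** diag_mat (\<chi> i. g' (s $ i)) ** transpose U ** (B - A))\<bar>
    = \<bar>\<Sum>i\<in>UNIV. \<Sum>j\<in>UNIV.
        (Q $ i $ j)\<^sup>2 * (g (t $ j) - g (s $ i) - g' (s $ i) * (t $ j - s $ i))\<bar>"
    unfolding tr gs gt by (simp add: right_diff_distrib sum_subtractf)
  also have "\<dots> \<le> (\<Sum>i\<in>UNIV. \<Sum>j\<in>UNIV.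
        \<bar>(Q $ i $ j)\<^sup>2 * (g (t $ j) - g (s $ i) - g' (s $ i) * (t $ j - s $ i))\<bar>)"
    by (rule order.trans[OF sum_abs]) (intro sum_mono sum_abs)
  also have "\<dots> \<le> (\<Sum>i\<in>(UNIV::'n set). \<Sum>j\<in>(UNIV::'n set). C * (real CARD('n) ^ 2 * e)\<^sup>2)"
  proof (intro sum_mono)
    fix i j :: 'n
    have "\<bar>(Q $ i $ j)\<^sup>2 * (g (t $ j) - g (s $ i) - g' (s $ i) * (t $ j - s $ i))\<bar>
        \<le> (Q $ i $ j)\<^sup>2 * (C * (t $ j - s $ i)\<^sup>2)"
      unfolding abs_mult abs_power2 by (intro mult_left_mono taylor) simp
    also have "\<dots> = C * \<bar>Q $ i $ j * (t $ j - s $ i)\<bar>\<^sup>2"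
      by (simp add: power_mult_distrib mult_ac)
    also have "\<dots> \<le> C * (real CARD('n) ^ 2 * e)\<^sup>2"
      using C off_le by (intro mult_left_mono power_mono) auto
    finally show "\<bar>(Q $ i $ j)\<^sup>2 * (g (t $ j) - g (s $ i) - g' (s $ i) * (t $ j - s $ i))\<bar>
        \<le> C * (real CARD('n) ^ 2 * e)\<^sup>2" .
  qed
  also have "\<dots> = C * real CARD('n) ^ 6 * e\<^sup>2"
    by (simp add: power_mult_distrib eval_nat_numeral mult_ac)
  finally show ?thesis .
qed

lemma has_derivative_quadratic_remainder:
  fixes f :: "'a::real_normed_vector \<Rightarrow> real"
  assumes D: "bounded_linear D" and rem: "\<And>y. \<bar>f y - f x - D (y - x)\<bar> \<le> K * (norm (y - x))\<^sup>2"
  shows "(f has_derivative D) (at x)"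
  unfolding has_derivative_iff_norm
proof (intro conjI D)
  have "norm (norm (f y - f x - D (y - x)) / norm (y - x)) \<le> K * norm (y - x)" for y
    \<comment> \<open>At \<open>y = x\<close> the quotient is 0 because division by zero yields
      zero.\<close>
    using rem[of y] by (cases "y = x") (simp_all add: divide_le_eq power2_eq_square mult.assoc)
  moreover have "((\<lambda>y. K * norm (y - x)) \<longlongrightarrow> 0) (at x)"
    by (rule tendsto_mult_right_zero[OF tendsto_norm_zero[OF LIM_zero[OF tendsto_ident_at]]])
  ultimately show "((\<lambda>y. norm (f y - f x - D (y - x)) / norm (y - x)) \<longlongrightarrow> 0) (at x)"
    by (rule Lim_null_comparison[OF always_eventually[OF allI]])
qed

section \<open>Row-by-row numbering of the strict upper triangle\<close>

lemma position_less_iff: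
  fixes i j :: "'a::{finite,linorder}"
  shows "position i < position j \<longleftrightarrow> i < j"
proof -
  have less: "position a < position b" if "a < b" for a b :: 'a
    unfolding position_def using that
    by (intro psubset_card_mono psubsetI) (auto simp: set_eq_iff not_le intro: exI[of _ b])
  then show ?thesis by (metis less_irrefl less_linear order_less_asym)
qed

text \<open>The first \<open>a\<close> rows and the remaining triangle of order \<open>n - a\<close>
  together fill the strict upper triangle. With \<open>a = position i\<close> this bounds the end of
  row \<open>i\<close> by the total number of entries.\<close>

lemma row_offset:
  "a \<le> n \<Longrightarrow> (\<Sum>k = 1..a. n - k) + (n - a) * (n - a - 1) div 2 = n * (n - 1) div 2" for n :: nat
proof (induction a)
  case (Suc a)
  then obtain m where m: "n - a = Suc m" by (metis Suc_diff_Suc Suc_le_lessD)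
  then have "n - Suc a = m" by simp
  moreover have "Suc m * m div 2 = m + m * (m - 1) div 2"
    by (cases m) (simp_all add: algebra_simps)
  ultimately show ?case using Suc m by simp
qed simp

text \<open>Each row occupies its own block of consecutive numbers, delimited by the partial sums of
  the row lengths; injectivity of the numbering rests on these blocks being disjoint.\<close>

lemma upper_index_in_row:
  fixes i j :: "'n::{finite,linorder}"
  assumes "i < j"
  shows "(\<Sum>k = 1..position i - 1. CARD('n) - k) < upper_index i j"
    and "upper_index i j \<le> (\<Sum>k = 1..position i. CARD('n) - k)"
proof -
  have lt: "position i < position j" using assms by (simp add: position_less_iff)
  have rng: "1 \<le> position i" "position j \<le> CARD('n)"
    using bij_betwE[OF bij_betw_position] by auto
  have idx: "upper_index i j = (\<Sum>k = 1..position i - 1. CARD('n) - k) + (position j - position i)"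
    using lt by (simp add: upper_index_def)
  have row: "(\<Sum>k = 1..position i. CARD('n) - k) = (\<Sum>k = 1..position i - 1. CARD('n) - k) + (CARD('n) - position i)"
    using rng(1) by (cases "position i") simp_all
  show "(\<Sum>k = 1..position i - 1. CARD('n) - k) < upper_index i j"
    using idx lt by simp
  show "upper_index i j \<le> (\<Sum>k = 1..position i. CARD('n) - k)"
    using idx row rng(2) by simp
qed

lemma upper_index_inject:
  fixes i j k l :: "'n::{finite,linorder}"
  assumes "i < j" "k < l" and eq: "upper_index i j = upper_index k l"
  shows "i = k \<and> j = l"
proof -
  have *: "upper_index i j < upper_index k l" if "i < k" "i < j" "k < l" for i j k l :: 'n
  proof -
    have "position i \<le> position k - 1" using that(1) position_less_iff[of i k] by simp
    then have "(\<Sum>k = 1..position i. CARD('n) - k) \<le> (\<Sum>k = 1..position k - 1. CARD('n) - k)"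
      by (intro sum_mono2) auto
    then show ?thesis
      using upper_index_in_row(2)[OF that(2)] upper_index_in_row(1)[OF that(3)] by linarith
  qed
  have ik: "i = k" using *[of i k j l] *[of k i l j] assms by (cases i k rule: linorder_cases) auto
  have "position j = position l"
    using eq assms(1,2) position_less_iff[of i j] position_less_iff[of k l]
    unfolding upper_index_def ik by simp
  then show ?thesis
    using ik position_less_iff[of j l] position_less_iff[of l j] by (cases j l rule: linorder_cases) auto
qed

lemma upper_index_range:
  fixes i j :: "'n::{finite,linorder}"
  assumes "i < j"
  shows "upper_index i j \<in> {1..CARD('n) * (CARD('n) - 1) div 2}"
proof -
  have "position i \<le> CARD('n)" using bij_betwE[OF bij_betw_position] by auto
  from row_offset[OF this] show ?thesis
    using upper_index_in_row[OF assms] by simp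
qed

text \<open>The coordinate of the vector that stores the entry \<open>(i, j)\<close>. It is
  meaningful only off the diagonal, hence the guards in \<open>unit_diag_mat_nth\<close> and in the
  candidate gradient \<open>G\<close> below.\<close>

definition entry_slot :: "'n::{finite,linorder} \<Rightarrow> 'n \<Rightarrow> 'm::{finite,linorder}" where
  "entry_slot i j = (THE d. position d = upper_index (min i j) (max i j))"

lemma unit_diag_mat_nth:
  "unit_diag_mat y $ i $ j = (if i = j then 1 else y $ entry_slot i j)"
  by (simp add: unit_diag_mat_def entry_slot_def)

lemma entry_slot_commute: "entry_slot i j = entry_slot j i"
  by (simp add: entry_slot_def min.commute max.commute)

text \<open>Each off-diagonal coordinate is shared by exactly two mirror entries, which is where the
  factor 2 in the gradient comes from.\<close>

lemma entry_slot_eq_iff: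
  fixes i j k l :: "'n::{finite,linorder}"
  assumes card: "CARD('m::{finite,linorder}) = CARD('n) * (CARD('n) - 1) div 2"
    and "i \<noteq> j" "k \<noteq> l"
  shows "(entry_slot i j :: 'm) = entry_slot k l \<longleftrightarrow> (i = k \<and> j = l) \<or> (i = l \<and> j = k)"
proof
  have pos: "position (entry_slot i j :: 'm) = upper_index (min i j) (max i j)" if "i \<noteq> j" for i j :: 'n
    unfolding entry_slot_def
  proof (rule theI')
    have "upper_index (min i j) (max i j) \<in> {1..CARD('m)}"
      unfolding card using that by (intro upper_index_range) (auto simp: min_def max_def)
    then show "\<exists>!d :: 'm. position d = upper_index (min i j) (max i j)"
      using bij_betw_position[where 'a = 'm] unfolding bij_betw_iff_bijections by (metis UNIV_I)
  qed
  assume "(entry_slot i j :: 'm) = entry_slot k l"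
  then have "upper_index (min i j) (max i j) = upper_index (min k l) (max k l)"
    using pos assms(2,3) by metis
  then have "min i j = min k l \<and> max i j = max k l"
    using assms(2,3) by (intro upper_index_inject) (auto simp: min_def max_def)
  then show "(i = k \<and> j = l) \<or> (i = l \<and> j = k)"
    by (auto simp: min_def max_def split: if_splits)
next
  assume "(i = k \<and> j = l) \<or> (i = l \<and> j = k)"
  then show "(entry_slot i j :: 'm) = entry_slot k l"
    using entry_slot_commute by metis
qed

lemma transpose_unit_diag_mat: "transpose (unit_diag_mat y) = unit_diag_mat y"
  by (auto simp: vec_eq_iff transpose_def unit_diag_mat_nth entry_slot_commute)

section \<open>Positive semidefiniteness through diagonalisation\<close>

lemma transpose_diagonalised:
  "transpose (U ** diag_mat d ** transpose U) = U ** diag_mat d ** transpose (U :: real^'n^'n)"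
proof -
  have "transpose (diag_mat d) = diag_mat d"
    by (auto simp: diag_mat_def transpose_def vec_eq_iff)
  then show ?thesis by (simp add: matrix_transpose_mul matrix_mul_assoc)
qed

lemma inner_diagonalised:
  fixes U :: "real^'n^'n"
  shows "v \<bullet> ((U ** diag_mat d ** transpose U) *v v) = (\<Sum>i\<in>UNIV. d $ i * ((transpose U *v v) $ i)\<^sup>2)"
proof -
  have "v \<bullet> ((U ** diag_mat d ** transpose U) *v v) = v \<bullet> (U *v (diag_mat d *v (transpose U *v v)))"
    by (simp only: matrix_vector_mul_assoc matrix_mul_assoc)
  also have "\<dots> = (transpose U *v v) \<bullet> (diag_mat d *v (transpose U *v v))"
    by (metis dot_lmul_matrix transpose_matrix_vector)
  also have "\<dots> = (\<Sum>i\<in>UNIV. d $ i * ((transpose U *v v) $ i)\<^sup>2)"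
  proof -
    have "(diag_mat d *v w) $ i = d $ i * w $ i" for w i
      by (simp add: matrix_vector_mult_def diag_mat_def if_distrib if_distribR cong: if_cong)
    then show ?thesis by (simp add: inner_vec_def power2_eq_square mult_ac)
  qed
  finally show ?thesis .
qed

lemma psd_diagonalised_iff:
  fixes U :: "real^'n^'n"
  assumes U: "orthogonal_matrix U"
  shows "psd (U ** diag_mat d ** transpose U) \<longleftrightarrow> (\<forall>i. 0 \<le> d $ i)"
proof
  assume psd: "psd (U ** diag_mat d ** transpose U)"
  show "\<forall>i. 0 \<le> d $ i"
  proof
    fix i
    \<comment> \<open>The test vector is the \<open>i\<close>-th column of \<open>U\<close>, on
      which the quadratic form takes the value \<open>d $ i\<close>.\<close>
    have "transpose U *v (U *v axis i 1) = axis i 1"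
      using U by (simp add: matrix_vector_mul_assoc orthogonal_matrix_def)
    then have "(U *v axis i 1) \<bullet> ((U ** diag_mat d ** transpose U) *v (U *v axis i 1)) = d $ i"
      by (simp only: inner_diagonalised)
        (simp add: axis_def if_distrib[where f = "\<lambda>x. x\<^sup>2"] if_distrib[where f = "\<lambda>x. d $ _ * x"] cong: if_cong)
    then show "0 \<le> d $ i" using psd unfolding psd_def by metis
  qed
next
  assume "\<forall>i. 0 \<le> d $ i"
  then show "psd (U ** diag_mat d ** transpose U)"
    by (simp add: psd_def transpose_diagonalised inner_diagonalised sum_nonneg)
qed

lemma psd_diag_nonneg:
  fixes A :: "real^'n^'n"
  assumes "psd A"
  shows "0 \<le> A $ i $ i"
proof -
  have "axis i 1 \<bullet> (A *v axis i 1) = A $ i $ i"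
    by (simp add: inner_axis' matrix_vector_mul_component inner_axis)
  then show ?thesis using assms unfolding psd_def by metis
qed

lemma psd_diag_mat: "psd (diag_mat d) \<longleftrightarrow> (\<forall>i. 0 \<le> d $ i)"
  using psd_diagonalised_iff[of "mat 1" d] by (simp add: orthogonal_matrix_id)

lemma psd_add:
  assumes "psd A" "psd B"
  shows "psd (A + B)"
proof -
  have "transpose (A + B) = transpose A + transpose B"
    by (simp add: transpose_def vec_eq_iff)
  with assms show ?thesis
    by (simp add: psd_def matrix_vector_mult_add_rdistrib inner_add_right)
qed

lemma diagonalised_diff_scaleR:
  fixes U :: "real^'n^'n"
  shows "U ** diag_mat (a - c *\<^sub>R b) ** transpose U =
    U ** diag_mat a ** transpose U - c *\<^sub>R (U ** diag_mat b ** transpose U)"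
proof -
  have "diag_mat (a - c *\<^sub>R b) = diag_mat a - c *\<^sub>R diag_mat b"
    by (simp add: diag_mat_def vec_eq_iff)
  then show ?thesis
    by (simp add: matrix_diff_distrib matrix_scalar_ac scalar_matrix_assoc)
qed

section \<open>The gradient in the vector parametrisation\<close>

lemma gradient_eqI:
  assumes "(f has_derivative (\<lambda>h. h \<bullet> G)) (at x)"
  shows "gradient f x = G"
  unfolding gradient_def
proof (rule the_equality)
  show "GDERIV f x :> G" using assms by (simp add: gderiv_def)
next
  fix G' assume "GDERIV f x :> G'"
  then have "(\<lambda>h. h \<bullet> G') = (\<lambda>h. h \<bullet> G)"
    using assms unfolding gderiv_def by (rule has_derivative_unique)
  then have "(G' - G) \<bullet> (G' - G) = 0" by (metis inner_diff_right right_minus_eq)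
  then show "G' = G" by simp
qed

text \<open>The matrix expansion is pulled back along the affine map \<open>unit_diag_mat\<close>.
  The hypothesis on \<open>f\<close> covers every diagonalisation, so \<open>x\<close> and
  \<open>y\<close> may use unrelated eigenbases.\<close>

lemma gradient_spectral_sum:
  fixes x :: "real^('m::{finite,linorder})" and U :: "real^('n::{finite,linorder})^('n::{finite,linorder})"
    and f :: "real^('m::{finite,linorder}) \<Rightarrow> real"
  assumes card: "CARD('m) = CARD('n) * (CARD('n) - 1) div 2"
    and U: "orthogonal_matrix U" and X: "unit_diag_mat x = U ** diag_mat s ** transpose U"
    and taylor: "\<And>a b. \<bar>g b - g a - g' a * (b - a)\<bar> \<le> C * (b - a)\<^sup>2"
    and f: "\<And>y (V :: real^('n::{finite,linorder})^('n::{finite,linorder})) t. orthogonal_matrix V \<Longrightarrow>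
      unit_diag_mat y = V ** diag_mat t ** transpose V \<Longrightarrow> f y = (\<Sum>j\<in>UNIV. g (t $ j))"
    and ij: "i \<noteq> j"
  shows "gradient f x $ entry_slot i j =
    2 * (U ** diag_mat (\<chi> i. g' (s $ i)) ** transpose U) $ i $ j"
proof -
  define W where "W = U ** diag_mat (\<chi> i. g' (s $ i)) ** transpose U"
  \<comment> \<open>The adjoint of the linear part of \<open>unit_diag_mat\<close> applied to
    \<open>W\<close>: each coordinate collects the entries of \<open>W\<close> at the places where
    it is stored.\<close>
  define G :: "real^('m::{finite,linorder})" where
    "G = (\<chi> d. \<Sum>k\<in>UNIV. \<Sum>l\<in>UNIV. if k \<noteq> l \<and> entry_slot k l = d then W $ k $ l else 0)"
  have W_sym: "W $ k $ l = W $ l $ k" for k l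
    using transpose_diagonalised[of U "\<chi> i. g' (s $ i)"] unfolding W_def[symmetric]
    by (metis transpose_def vec_lambda_beta)
  \<comment> \<open>The diagonal of \<open>W\<close> drops out, since both matrices have unit
    diagonal and their difference vanishes there.\<close>
  have inner_G: "(y - x) \<bullet> G = trace (W ** (unit_diag_mat y - unit_diag_mat x))" for y
  proof -
    have "(y - x) \<bullet> G = (\<Sum>d\<in>UNIV. \<Sum>k\<in>UNIV. \<Sum>l\<in>UNIV.
        if entry_slot k l = d then (if k \<noteq> l then W $ k $ l * (y - x) $ d else 0) else 0)"
      by (auto simp: inner_vec_def G_def sum_distrib_left intro!: sum.cong)
    also have "\<dots> = (\<Sum>k\<in>UNIV. \<Sum>l\<in>UNIV. \<Sum>d\<in>UNIV.
        if entry_slot k l = d then (if k \<noteq> l then W $ k $ l * (y - x) $ d else 0) else 0)"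
      by (subst sum.swap, rule sum.cong[OF refl], rule sum.swap)
    also have "\<dots> = (\<Sum>k\<in>UNIV. \<Sum>l\<in>UNIV. W $ k $ l * (unit_diag_mat y - unit_diag_mat x) $ l $ k)"
      by (auto simp: unit_diag_mat_nth entry_slot_commute intro!: sum.cong)
    finally show ?thesis by (simp add: trace_def matrix_matrix_mult_def)
  qed
  have "\<bar>f y - f x - (y - x) \<bullet> G\<bar> \<le> C * real CARD('n) ^ 6 * (norm (y - x))\<^sup>2" for y
  proof -
    obtain V :: "real^('n::{finite,linorder})^('n::{finite,linorder})" and t where V: "orthogonal_matrix V"
        "unit_diag_mat y = V ** diag_mat t ** transpose V"
      using symmetric_orthogonal_diagonalisation[OF transpose_unit_diag_mat] by blast
    have "\<bar>(unit_diag_mat y - unit_diag_mat x) $ k $ l\<bar> \<le> norm (y - x)" for k l :: 'n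
      using component_le_norm_cart[of "y - x" "entry_slot k l"] by (simp add: unit_diag_mat_nth)
    from spectral_sum_remainder[OF U V(1) X V(2) taylor this] show ?thesis
      by (simp add: f[OF V] f[OF U X] inner_G W_def)
  qed
  then have "(f has_derivative (\<lambda>h. h \<bullet> G)) (at x)"
    by (intro has_derivative_quadratic_remainder bounded_linear_inner_left)
  then have "gradient f x = G" by (rule gradient_eqI)
  moreover have "G $ entry_slot i j = (\<Sum>k\<in>UNIV. \<Sum>l\<in>UNIV.
      (if k = i then if l = j then W $ i $ j else 0 else 0) + (if k = j then if l = i then W $ j $ i else 0 else 0))"
    unfolding G_def vec_lambda_beta
    using ij entry_slot_eq_iff[OF card _ ij] by (intro sum.cong refl) auto
  moreover have "\<dots> = 2 * W $ i $ j"
    using W_sym[of i j] by (simp add: sum.distrib sum.If_cases)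
  ultimately show ?thesis by (simp add: W_def)
qed

section \<open>Positive semidefiniteness after the gradient step\<close>

theorem theorem2:
  fixes X :: "real^('m::{finite,linorder}) \<Rightarrow> real^('n::{finite,linorder})^('n::{finite,linorder})"
    and f :: "real^('m::{finite,linorder}) \<Rightarrow> real"
    and x :: "real^('m::{finite,linorder})"
    and \<epsilon> p \<alpha> :: real
  defines "X \<equiv> unit_diag_mat"
    and "f \<equiv> (\<lambda>y. smoothed_schatten \<epsilon> p (X y))"
  assumes "CARD('n) \<ge> 2"
    and "CARD('m) = CARD('n) * (CARD('n) - 1) div 2"
    and "\<epsilon> > 0" and "0 < p" and "p \<le> 2"
    and "psd (X x)"
    and "0 \<le> \<alpha>" and "\<alpha> \<le> 1 / (2 * p) * \<epsilon> powr ((2 - p) / 2)"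
  shows "psd (X (x - \<alpha> *\<^sub>R gradient f x))"
proof -
  note card = assms(4) and \<epsilon> = assms(5) and p = assms(6,7) and \<alpha> = assms(9,10)
  have "transpose (X x) = X x" unfolding X_def by (rule transpose_unit_diag_mat)
  then obtain U s where U: "orthogonal_matrix U" and Xx: "X x = U ** diag_mat s ** transpose U"
    by (rule symmetric_orthogonal_diagonalisation)
  have s: "0 \<le> s $ i" for i
    using assms(8) psd_diagonalised_iff[OF U] unfolding Xx by blast
  define g' where "g' = (\<lambda>a. p * a * (a\<^sup>2 + \<epsilon>) powr (p / 2 - 1))"
  define r where "r = (\<chi> i. g' (s $ i))"
  define W where "W = U ** diag_mat r ** transpose U"
  have "gradient f x $ entry_slot i j = 2 * W $ i $ j" if "i \<noteq> j" for i j :: 'n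
    unfolding W_def r_def
    using smoothed_power_taylor[OF \<epsilon> p]
    by (intro gradient_spectral_sum[OF card U Xx[unfolded X_def] _ _ that,
          where g = "\<lambda>a. (a\<^sup>2 + \<epsilon>) powr (p / 2)"])
      (auto simp: g'_def f_def X_def smoothed_schatten_diagonalised)
  \<comment> \<open>The step changes only off-diagonal entries, whereas subtracting
    \<open>(2 * \<alpha>) *\<^sub>R W\<close> also lowers the diagonal; the diagonal summand
    restores it to 1.\<close>
  then have "X (x - \<alpha> *\<^sub>R gradient f x) = (X x - (2 * \<alpha>) *\<^sub>R W) + diag_mat (\<chi> i. 2 * \<alpha> * W $ i $ i)"
    by (simp add: X_def unit_diag_mat_nth vec_eq_iff diag_mat_def)
  also have "X x - (2 * \<alpha>) *\<^sub>R W = U ** diag_mat (s - (2 * \<alpha>) *\<^sub>R r) ** transpose U"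
    by (simp add: Xx W_def diagonalised_diff_scaleR)
  finally have decomp: "X (x - \<alpha> *\<^sub>R gradient f x) =
      U ** diag_mat (s - (2 * \<alpha>) *\<^sub>R r) ** transpose U + diag_mat (\<chi> i. 2 * \<alpha> * W $ i $ i)" .
  have "2 * \<alpha> * r $ i \<le> s $ i" for i
  proof -
    let ?q = "p / 2 - 1"
    \<comment> \<open>The exponent \<open>?q\<close> is nonpositive because
      \<open>p \<le> 2\<close>. The step size bound says
      \<open>2 * \<alpha> * p \<le> \<epsilon> powr ((2 - p) / 2)\<close>, and this exponent is
      exactly \<open>- ?q\<close>, so the two powers of \<open>\<epsilon>\<close> cancel.\<close>
    have "((s $ i)\<^sup>2 + \<epsilon>) powr ?q \<le> \<epsilon> powr ?q"
      using \<epsilon> p by (intro powr_mono2') auto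
    then have "2 * \<alpha> * p * ((s $ i)\<^sup>2 + \<epsilon>) powr ?q \<le> 2 * \<alpha> * p * \<epsilon> powr ?q"
      using \<alpha>(1) p by (intro mult_left_mono) auto
    also have "\<dots> \<le> \<epsilon> powr ((2 - p) / 2) * \<epsilon> powr ?q"
      using \<alpha>(2) p by (intro mult_right_mono) (auto simp: field_simps)
    also have "\<dots> = 1" using \<epsilon> by (simp add: field_simps flip: powr_add)
    finally have "(2 * \<alpha> * p * ((s $ i)\<^sup>2 + \<epsilon>) powr ?q) * s $ i \<le> 1 * s $ i"
      using s by (intro mult_right_mono) auto
    then show ?thesis by (simp add: r_def g'_def mult_ac)
  qed
  then have "psd (U ** diag_mat (s - (2 * \<alpha>) *\<^sub>R r) ** transpose U)"
    by (simp add: psd_diagonalised_iff[OF U])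
  \<comment> \<open>Since \<open>g'\<close> is nonnegative on nonnegative eigenvalues,
    \<open>W\<close> is positive semidefinite and hence has a nonnegative diagonal.\<close>
  moreover have "psd W"
    using s p by (simp add: W_def psd_diagonalised_iff[OF U] r_def g'_def)
  then have "psd (diag_mat (\<chi> i. 2 * \<alpha> * W $ i $ i))"
    using \<alpha>(1) by (simp add: psd_diag_mat psd_diag_nonneg)
  ultimately show ?thesis
    unfolding decomp by (rule psd_add)
qed

end
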